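(* Consider a polynomial shape Bratteli diagram associated to a homogeneous positive integer polynomial of degree $d\ge1$ in $q\ge2$ variables, with path space $X$. For every edge ordering, the set of maximal paths and the set of minimal paths have measure zero for every fully supported ergodic invariant Borel probability measure on $X$.
   Context: A Bratteli diagram is a graded directed graph with vertex set $\mathcal V=\bigsqcup_{n\ge0}\mathcal V_n$ ($\mathcal V_n$ finite nonempty, $\mathcal V_0$ a single vertex, the root) and edge set $\mathcal E=\bigsqcup_{n\ge 0}\mathcal E_n$ ($\mathcal E_n$ finite nonempty), each edge $e\in\mathcal E_n$ having source $s(e)\in\mathcal V_n$ and target $t(e)\in\mathcal V_{n+1}$; every vertex has an outgoing edge, every vertex other than the root has an incoming edge, and multiple edges are allowed. The path space $X$ is the set of infinite paths $x=x_0x_1\dots$, $x_n\in\mathcal E_n$, $t(x_n)=s(x_{n+1})$, with the topology generated by the cylinder sets $x_{[0,n]}=\{y\in X: y_i=x_i,\ 0\le i\le n\}$. Write $v_n(x)=s(x_n)=t(x_{n-1})$. Polynomial shape: let $p(x_1,\dots,x_q)=\sum_{m_1+\dots+m_q=d}a_{(m_1,\dots,m_q)}x_1^{m_1}\cdots x_q^{m_q}$ be homogeneous of degree $d\geq1$ with every $a_{(m_1,\dots,m_q)}$ a positive integer, and let $S$ be the set of vectors $s\in\mathbb Z_{\ge0}^q$ whose coordinates sum to $d$. A Bratteli diagram has polynomial shape and is associated to $p$ if for every $n\ge0$, $\mathcal V_n$ is (identified with) the set of vectors in $\mathbb Z_{\geq 0}^q$ whose coordinates sum to $nd$, and for $u\in\mathcal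 V_n$, $w\in\mathcal V_{n+1}$ there is at least one edge from $u$ to $w$ if and only if $w-u\in S$ (the positive number of edges between connected vertices is arbitrary). An ordering is a map $\xi:\mathcal E\to\mathbb N$ which, for each vertex $w$ other than the root, restricts to a bijection from $t^{-1}\{w\}$ onto $\{1,\dots,|t^{-1}\{w\}|\}$. A path is minimal (maximal) if all its edges are minimal (maximal) among the edges entering their targets. An invariant set is one saturated for the tail equivalence relation (two paths are tail equivalent if they agree from some level on). A Borel probability measure $\mu$ on $X$ is invariant if for every vertex $w\in\mathcal V_{n}$ it assigns equal measure to all the cylinder sets determined by finite paths from the root to $w$. It is ergodic if every invariant Borel set has measure $0$ or $1$, and fully supported if every nonempty open set has positive measure. *)

theory Defs
  imports "HOL-Probability.Probability" "HOL-Library.Poly_Mapping"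
begin

section \<open>Bratteli diagrams\<close>

text \<open>Multiple edges are allowed: edges are abstract objects with a source and a target.\<close>

record ('v, 'e) bratteli =
  verts :: "nat \<Rightarrow> 'v set"
  edges :: "nat \<Rightarrow> 'e set"
  src :: "'e \<Rightarrow> 'v"
  tgt :: "'e \<Rightarrow> 'v"

locale bratteli_diagram =
  fixes B :: "('v, 'e) bratteli"
  assumes finite_verts: "finite (verts B n)"
    and verts_nonempty: "verts B n \<noteq> {}"
    and single_root: "card (verts B 0) = 1"
    and verts_disjoint: "m \<noteq> n \<Longrightarrow> verts B m \<inter> verts B n = {}"
    and finite_edges: "finite (edges B n)"
    and edges_nonempty: "edges B n \<noteq> {}"
    and edges_disjoint: "m \<noteq> n \<Longrightarrow> edges B m \<inter> edges B n = {}"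
    and src_in: "e \<in> edges B n \<Longrightarrow> src B e \<in> verts B n"
    and tgt_in: "e \<in> edges B n \<Longrightarrow> tgt B e \<in> verts B (Suc n)"
    and ex_outgoing: "v \<in> verts B n \<Longrightarrow> \<exists>e \<in> edges B n. src B e = v"
    and ex_incoming: "v \<in> verts B (Suc n) \<Longrightarrow> \<exists>e \<in> edges B n. tgt B e = v"

definition in_edges :: "('v, 'e) bratteli \<Rightarrow> 'v \<Rightarrow> 'e set" where
  "in_edges B w = {e \<in> (\<Union>n. edges B n). tgt B e = w}"

definition path_space :: "('v, 'e) bratteli \<Rightarrow> (nat \<Rightarrow> 'e) set" where
  "path_space B = {x. \<forall>n. x n \<in> edges B n \<and> tgt B (x n) = src B (x (Suc n))}"

text \<open>Finite paths from the root to \<open>w\<close>, as lists of edges; the path to the root itself is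
  empty.\<close>

definition finite_paths_to :: "('v, 'e) bratteli \<Rightarrow> 'v \<Rightarrow> 'e list set" where
  "finite_paths_to B w = {es. w \<in> verts B (length es) \<and>
     (\<forall>i < length es. es ! i \<in> edges B i) \<and>
     (\<forall>i. Suc i < length es \<longrightarrow> tgt B (es ! i) = src B (es ! Suc i)) \<and>
     (es \<noteq> [] \<longrightarrow> tgt B (last es) = w)}"

definition cylinder :: "('v, 'e) bratteli \<Rightarrow> 'e list \<Rightarrow> (nat \<Rightarrow> 'e) set" where
  "cylinder B es = {y \<in> path_space B. \<forall>i < length es. y i = es ! i}"

definition path_topology :: "('v, 'e) bratteli \<Rightarrow> (nat \<Rightarrow> 'e) topology" where
  "path_topology B = topology_generated_by
     {cylinder B (map x [0..<Suc n]) | x n. x \<in> path_space B}"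

lemma topspace_path_topology [simp]: "topspace (path_topology B) = path_space B"
proof -
  have "x \<in> cylinder B (map x [0..<Suc 0])" if "x \<in> path_space B" for x
    using that by (simp add: cylinder_def)
  moreover have "cylinder B es \<subseteq> path_space B" for es
    by (auto simp: cylinder_def)
  ultimately show ?thesis
    unfolding path_topology_def topology_generated_by_topspace by blast
qed

definition path_borel :: "('v, 'e) bratteli \<Rightarrow> (nat \<Rightarrow> 'e) measure" where
  "path_borel B = sigma (path_space B) {U. openin (path_topology B) U}"

lemma space_path_borel [simp]: "space (path_borel B) = path_space B"
  unfolding path_borel_def by (rule space_measure_of) (use openin_subset [where U = "path_topology B"] in auto)

lemma sets_path_borel:
  "sets (path_borel B) = sigma_sets (path_space B) {U. openin (path_topology B) U}"
  unfolding path_borel_def by (rule sets_measure_of) (use openin_subset [where U = "path_topology B"] in auto)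


section \<open>Edge orderings\<close>

definition edge_ordering :: "('v, 'e) bratteli \<Rightarrow> ('e \<Rightarrow> nat) \<Rightarrow> bool" where
  "edge_ordering B \<xi> \<longleftrightarrow>
     (\<forall>w \<in> (\<Union>n. verts B n) - verts B 0. bij_betw \<xi> (in_edges B w) {1..card (in_edges B w)})"

definition minimal_paths :: "('v, 'e) bratteli \<Rightarrow> ('e \<Rightarrow> nat) \<Rightarrow> (nat \<Rightarrow> 'e) set" where
  "minimal_paths B \<xi> = {x \<in> path_space B. \<forall>n. \<forall>e \<in> in_edges B (tgt B (x n)). \<xi> (x n) \<le> \<xi> e}"

definition maximal_paths :: "('v, 'e) bratteli \<Rightarrow> ('e \<Rightarrow> nat) \<Rightarrow> (nat \<Rightarrow> 'e) set" where
  "maximal_paths B \<xi> = {x \<in> path_space B. \<forall>n. \<forall>e \<in> in_edges B (tgt B (x n)). \<xi> e \<le> \<xi> (x n)}"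


section \<open>Invariant measures\<close>

definition tail_equivalent :: "(nat \<Rightarrow> 'e) \<Rightarrow> (nat \<Rightarrow> 'e) \<Rightarrow> bool" where
  "tail_equivalent x y \<longleftrightarrow> (\<exists>N. \<forall>n \<ge> N. x n = y n)"

definition invariant_set :: "('v, 'e) bratteli \<Rightarrow> (nat \<Rightarrow> 'e) set \<Rightarrow> bool" where
  "invariant_set B A \<longleftrightarrow> A \<subseteq> path_space B \<and>
     (\<forall>x \<in> A. \<forall>y \<in> path_space B. tail_equivalent x y \<longrightarrow> y \<in> A)"

definition borel_probability :: "('v, 'e) bratteli \<Rightarrow> (nat \<Rightarrow> 'e) measure \<Rightarrow> bool" where
  "borel_probability B \<mu> \<longleftrightarrow> prob_space \<mu> \<and> sets \<mu> = sets (path_borel B)"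

definition invariant_measure :: "('v, 'e) bratteli \<Rightarrow> (nat \<Rightarrow> 'e) measure \<Rightarrow> bool" where
  "invariant_measure B \<mu> \<longleftrightarrow>
     (\<forall>n. \<forall>w \<in> verts B n. \<forall>es \<in> finite_paths_to B w. \<forall>es' \<in> finite_paths_to B w.
        emeasure \<mu> (cylinder B es) = emeasure \<mu> (cylinder B es'))"

definition ergodic_measure :: "('v, 'e) bratteli \<Rightarrow> (nat \<Rightarrow> 'e) measure \<Rightarrow> bool" where
  "ergodic_measure B \<mu> \<longleftrightarrow>
     (\<forall>A \<in> sets \<mu>. invariant_set B A \<longrightarrow> emeasure \<mu> A = 0 \<or> emeasure \<mu> A = 1)"

definition fully_supported :: "('v, 'e) bratteli \<Rightarrow> (nat \<Rightarrow> 'e) measure \<Rightarrow> bool" where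
  "fully_supported B \<mu> \<longleftrightarrow>
     (\<forall>U. openin (path_topology B) U \<longrightarrow> U \<noteq> {} \<longrightarrow> emeasure \<mu> U > 0)"


section \<open>Polynomial shape\<close>

text \<open>A polynomial with integer coefficients in variables indexed by the finite type \<open>'q\<close> is a
  finitely supported map from exponent vectors to coefficients.\<close>

type_synonym 'q int_mpoly = "(nat ^ 'q) \<Rightarrow>\<^sub>0 int"

definition vectors_of_sum :: "nat \<Rightarrow> (nat ^ 'q::finite) set" where
  "vectors_of_sum k = {v. (\<Sum>i\<in>UNIV. v $ i) = k}"

definition positive_homogeneous :: "nat \<Rightarrow> 'q::finite int_mpoly \<Rightarrow> bool" where
  "positive_homogeneous d p \<longleftrightarrow>
     (\<forall>m. if m \<in> vectors_of_sum d then Poly_Mapping.lookup p m > 0 else Poly_Mapping.lookup p m = 0)"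

text \<open>The condition \<open>w - u \<in> S\<close> (with the difference taken over the integers) is expressed
  without truncated subtraction.  The number of edges between connected vertices is not tied to
  the coefficients of \<open>p\<close>.\<close>

definition polynomial_shape ::
    "nat \<Rightarrow> 'q::finite int_mpoly \<Rightarrow> (nat ^ 'q, 'e) bratteli \<Rightarrow> bool" where
  "polynomial_shape d p B \<longleftrightarrow> positive_homogeneous d p \<and> bratteli_diagram B \<and>
     (\<forall>n. verts B n = vectors_of_sum (n * d)) \<and>
     (\<forall>n. \<forall>u \<in> verts B n. \<forall>w \<in> verts B (Suc n).
        (\<exists>e \<in> edges B n. src B e = u \<and> tgt B e = w) \<longleftrightarrow>
        (\<exists>s \<in> vectors_of_sum d. w = u + s))"

end

theory Submission
  imports Defs
begin

text \<open>
  The two sets have the form \<open>M = {x. \<forall>n. P (x n)}\<close>, where \<open>P\<close> selects at most one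
  of the edges entering each vertex; hence a path in \<open>M\<close> through a vertex \<open>w\<close> is determined up to
  \<open>w\<close>.  Call a vertex an axis vertex if it has at most one nonzero coordinate.

  A vertex \<open>w\<close> of level \<open>n\<close> that is not on an axis is reached by at least \<open>n\<close> finite paths
  (\<open>many_paths_off_axes\<close>): it has two distinct predecessors, one of which is again off the axes
  unless \<open>n\<close> is small.  The cylinders of these paths are disjoint and by invariance have equal
  measure, so the part of \<open>M\<close> passing through \<open>w\<close> takes up at most \<open>1 / n\<close> of the measure of all
  paths through \<open>w\<close>.  Summation over \<open>w\<close> shows that the part of \<open>M\<close> that is off the axes at level
  \<open>n\<close> has measure at most \<open>1 / n\<close> (\<open>measure_selected_le\<close>).  Coordinates do not decrease along a
  path, so a path that has left the axes never returns; these parts of \<open>M\<close> therefore increase with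
  \<open>n\<close>, and all of them are null.

  What remains of \<open>M\<close> lies in the finitely many sets of paths that stay on a fixed axis forever.
  Such a set is invariant, so by ergodicity it has measure \<open>0\<close> or \<open>1\<close>; its complement contains the
  nonempty open set of paths that start along another axis, so by full support it is null
  (\<open>axis_paths_null\<close>).
\<close>

section \<open>Path spaces of Bratteli diagrams\<close>

lemma openin_initial_segment:
  "openin (path_topology B) {x \<in> path_space B. Q (map x [0..<n])}"
proof -
  let ?U = "{x \<in> path_space B. Q (map x [0..<n])}"
  let ?C = "\<lambda>x. cylinder B (map x [0..<Suc n])"
  have "?U = \<Union>(?C ` ?U)"
  proof (intro equalityI subsetI)
    fix x assume "x \<in> ?U"
    moreover from this have "x \<in> ?C x" by (simp add: cylinder_def del: upt_Suc)
    ultimately show "x \<in> \<Union>(?C ` ?U)" by blast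
  next
    fix y assume "y \<in> \<Union>(?C ` ?U)"
    then obtain x where x: "x \<in> ?U" "y \<in> ?C x" by blast
    have "y i = x i" if "i < n" for i
      using x(2) that by (auto simp: cylinder_def nth_append)
    then have "map y [0..<n] = map x [0..<n]" by simp
    with x have "Q (map y [0..<n])" by (metis (no_types, lifting) mem_Collect_eq)
    with x(2) show "y \<in> ?U" by (simp add: cylinder_def)
  qed
  moreover have "openin (path_topology B) (?C x)" if "x \<in> path_space B" for x
    unfolding path_topology_def by (rule topology_generated_by_Basis) (use that in blast)
  then have "openin (path_topology B) (\<Union>(?C ` ?U))" by (intro openin_Union) auto
  ultimately show ?thesis by simp
qed

lemma openin_coordinate: "openin (path_topology B) {x \<in> path_space B. Q (x n)}"
  using openin_initial_segment[of B "\<lambda>es. Q (es ! n)" "Suc n"] by (simp del: upt_Suc)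

lemma sets_openin:
  assumes "borel_probability B \<mu>" "openin (path_topology B) U"
  shows "U \<in> sets \<mu>"
  using assms by (auto simp: borel_probability_def sets_path_borel)

lemma sets_coordinate:
  assumes "borel_probability B \<mu>"
  shows "{x \<in> path_space B. Q (x n)} \<in> sets \<mu>"
  by (rule sets_openin[OF assms openin_coordinate])

lemma sets_all_coordinates:
  assumes "borel_probability B \<mu>"
  shows "{x \<in> path_space B. \<forall>n. Q n (x n)} \<in> sets \<mu>"
proof -
  have "{x \<in> path_space B. \<forall>n. Q n (x n)} = (\<Inter>n. {x \<in> path_space B. Q n (x n)})" by auto
  moreover have "(\<Inter>n. {x \<in> path_space B. Q n (x n)}) \<in> sets \<mu>"
    by (rule sets.countable_INT') (use sets_coordinate[OF assms] in auto)
  ultimately show ?thesis by simp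
qed

lemma sets_cylinder:
  assumes "borel_probability B \<mu>"
  shows "cylinder B es \<in> sets \<mu>"
  unfolding cylinder_def by (rule sets_all_coordinates[OF assms])

lemma path_spaceD:
  assumes "x \<in> path_space B"
  shows "x n \<in> edges B n" "tgt B (x n) = src B (x (Suc n))"
  using assms by (auto simp: path_space_def)

lemma cylinders_disjoint:
  assumes "length es = length es'" "es \<noteq> es'"
  shows "cylinder B es \<inter> cylinder B es' = {}"
  using assms by (auto simp: cylinder_def list_eq_iff_nth_eq)

context bratteli_diagram
begin

lemma length_finite_path:
  assumes "w \<in> verts B n" "es \<in> finite_paths_to B w"
  shows "length es = n"
  using assms verts_disjoint[of n "length es"] by (auto simp: finite_paths_to_def)

lemma append_edge_finite_path:
  assumes "u \<in> verts B n" "es \<in> finite_paths_to B u" "e \<in> edges B n" "src B e = u"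
  shows "es @ [e] \<in> finite_paths_to B (tgt B e)"
proof -
  have len: "length es = n" using length_finite_path assms by blast
  have lst: "tgt B (es ! i) = u" if "Suc i = n" for i
  proof -
    have "es \<noteq> []" using that len by auto
    moreover have "last es = es ! i" using that len by (metis last_conv_nth diff_Suc_1 calculation)
    ultimately show ?thesis using assms(2) by (simp add: finite_paths_to_def)
  qed
  show ?thesis
    using assms len lst tgt_in[OF assms(3)]
    by (auto simp: finite_paths_to_def nth_append less_Suc_eq)
qed

lemma ex_finite_path: "w \<in> verts B n \<Longrightarrow> \<exists>es. es \<in> finite_paths_to B w"
proof (induction n arbitrary: w)
  case 0
  then have "[] \<in> finite_paths_to B w" by (simp add: finite_paths_to_def)
  then show ?case by blast
next
  case (Suc n)
  obtain e where e: "e \<in> edges B n" "tgt B e = w" using ex_incoming[OF Suc.prems] by blast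
  obtain es where "es \<in> finite_paths_to B (src B e)" using Suc.IH[OF src_in[OF e(1)]] by blast
  then show ?case using append_edge_finite_path[OF src_in[OF e(1)] _ e(1)] e(2) by blast
qed

lemma ex_path_from_edge:
  assumes "e \<in> edges B 0"
  shows "\<exists>x \<in> path_space B. x 0 = e"
proof -
  have "\<exists>x. \<forall>n. (x n \<in> edges B n \<and> (n = 0 \<longrightarrow> x n = e)) \<and> src B (x (Suc n)) = tgt B (x n)"
  proof (rule dependent_nat_choice)
    fix x n assume "x \<in> edges B n \<and> (n = 0 \<longrightarrow> x = e)"
    then show "\<exists>y. (y \<in> edges B (Suc n) \<and> (Suc n = 0 \<longrightarrow> y = e)) \<and> src B y = tgt B x"
      using ex_outgoing[OF tgt_in, of x n] by auto
  qed (use assms in auto)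
  then show ?thesis by (auto simp: path_space_def)
qed

lemma initial_segment_finite_path:
  assumes "x \<in> path_space B"
  shows "map x [0..<n] \<in> finite_paths_to B (src B (x n))"
  using path_spaceD[OF assms] src_in by (auto simp: finite_paths_to_def last_map)

lemma cylinder_through_vertex:
  assumes "w \<in> verts B n" "es \<in> finite_paths_to B w"
  shows "cylinder B es \<subseteq> {x \<in> path_space B. src B (x n) = w}"
proof
  fix x assume x: "x \<in> cylinder B es"
  then have px: "x \<in> path_space B" by (simp add: cylinder_def)
  have len: "length es = n" using length_finite_path assms by blast
  have "src B (x n) = w"
  proof (cases n)
    case 0
    \<comment> \<open>The empty path carries no edge; here the claim holds because the root is unique.\<close>
    then have "src B (x n) \<in> verts B 0" "w \<in> verts B 0"
      using src_in[OF path_spaceD(1)[OF px]] assms(1) by auto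
    then show ?thesis using single_root by (auto simp: card_1_singleton_iff)
  next
    case (Suc m)
    then have "es \<noteq> []" using len by auto
    then have "last es = x m" using x len Suc by (simp add: cylinder_def last_conv_nth)
    moreover have "tgt B (last es) = w" using assms(2) Suc len by (auto simp: finite_paths_to_def)
    ultimately show ?thesis using path_spaceD(2)[OF px, of m] Suc by simp
  qed
  with px show "x \<in> {x \<in> path_space B. src B (x n) = w}" by simp
qed

lemma selected_paths_determined:
  assumes "\<And>n e e'. \<lbrakk>e \<in> edges B n; e' \<in> edges B n; P e; P e'; tgt B e = tgt B e'\<rbrakk> \<Longrightarrow> e = e'"
    and "x \<in> path_space B" "\<And>n. P (x n)" "y \<in> path_space B" "\<And>n. P (y n)"
  shows "src B (x n) = src B (y n) \<Longrightarrow> map x [0..<n] = map y [0..<n]"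
proof (induction n)
  case (Suc n)
  have "x n = y n"
    by (rule assms(1)[OF path_spaceD(1) path_spaceD(1)])
      (use assms Suc.prems path_spaceD(2)[of _ B n] in auto)
  with Suc.IH show ?case by simp
qed simp

text \<open>The paths selected by \<open>P\<close> use at most one finite path to each vertex.  If every vertex of a
  set \<open>W\<close> of vertices of level \<open>n\<close> is reached by at least \<open>k\<close> finite paths, which all have the
  same measure, then the selected paths through \<open>W\<close> have at most a fraction \<open>1 / k\<close> of the total
  mass.\<close>

lemma measure_selected_le:
  assumes bp: "borel_probability B \<mu>" and inv: "invariant_measure B \<mu>"
    and P: "\<And>n e e'. \<lbrakk>e \<in> edges B n; e' \<in> edges B n; P e; P e'; tgt B e = tgt B e'\<rbrakk> \<Longrightarrow> e = e'"
    and W: "W \<subseteq> verts B n"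
    and paths: "\<And>w. w \<in> W \<Longrightarrow> \<exists>F. F \<subseteq> finite_paths_to B w \<and> finite F \<and> card F = k"
  shows "real k * measure \<mu> {x \<in> path_space B. (\<forall>m. P (x m)) \<and> src B (x n) \<in> W} \<le> 1"
proof -
  interpret prob_space \<mu> using bp by (simp add: borel_probability_def)
  let ?T = "\<lambda>w. {x \<in> path_space B. src B (x n) = w}"
  let ?M = "\<lambda>w. {x \<in> path_space B. \<forall>m. P (x m)} \<inter> ?T w"
  have sT: "?T w \<in> sets \<mu>" for w by (rule sets_coordinate[OF bp])
  have sM: "?M w \<in> sets \<mu>" for w by (rule sets.Int[OF sets_all_coordinates[OF bp] sT])
  have finW: "finite W" using W finite_verts finite_subset by blast
  have le: "real k * measure \<mu> (?M w) \<le> measure \<mu> (?T w)" if w: "w \<in> W" for w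
  proof (cases "?M w = {}")
    case True
    show ?thesis unfolding True by simp
  next
    case False
    then obtain x where x: "x \<in> path_space B" "\<And>m. P (x m)" "src B (x n) = w" by blast
    define es where "es = map x [0..<n]"
    have es: "es \<in> finite_paths_to B w"
      using initial_segment_finite_path[OF x(1), of n] x(3) by (simp add: es_def)
    have "?M w \<subseteq> cylinder B es"
    proof
      fix y assume y: "y \<in> ?M w"
      then have "map y [0..<n] = es"
        unfolding es_def using x by (intro selected_paths_determined[of P] P) auto
      with y show "y \<in> cylinder B es" by (auto simp: cylinder_def)
    qed
    then have M_le: "measure \<mu> (?M w) \<le> measure \<mu> (cylinder B es)"
      by (intro finite_measure_mono sets_cylinder[OF bp])
    obtain F where F: "F \<subseteq> finite_paths_to B w" "finite F" "card F = k" using paths[OF w] by blast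
    have wn: "w \<in> verts B n" using w W by blast
    have "measure \<mu> (cylinder B es') = measure \<mu> (cylinder B es)" if "es' \<in> F" for es'
    proof -
      have "emeasure \<mu> (cylinder B es') = emeasure \<mu> (cylinder B es)"
        using inv wn es that F(1) unfolding invariant_measure_def by blast
      then show ?thesis by (simp add: measure_def)
    qed
    then have "real k * measure \<mu> (cylinder B es) = (\<Sum>es'\<in>F. measure \<mu> (cylinder B es'))"
      using F(3) by simp
    also have "\<dots> = measure \<mu> (\<Union>es'\<in>F. cylinder B es')"
    proof (rule finite_measure_finite_Union[symmetric])
      show "disjoint_family_on (cylinder B) F"
        unfolding disjoint_family_on_def
      proof (intro ballI impI)
        fix es1 es2 assume "es1 \<in> F" "es2 \<in> F" "es1 \<noteq> es2"
        then show "cylinder B es1 \<inter> cylinder B es2 = {}"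
          using cylinders_disjoint length_finite_path[OF wn] F(1) by (metis subsetD)
      qed
    next
      show "cylinder B ` F \<subseteq> events" using sets_cylinder[OF bp] by blast
    qed (rule F(2))
    also have "\<dots> \<le> measure \<mu> (?T w)"
      by (rule finite_measure_mono[OF _ sT]) (use cylinder_through_vertex[OF wn] F(1) in blast)
    finally show ?thesis
      using mult_left_mono[OF M_le, of "real k"] by simp
  qed
  have "{x \<in> path_space B. (\<forall>m. P (x m)) \<and> src B (x n) \<in> W} = (\<Union>w\<in>W. ?M w)" by blast
  then have "measure \<mu> {x \<in> path_space B. (\<forall>m. P (x m)) \<and> src B (x n) \<in> W}
      \<le> (\<Sum>w\<in>W. measure \<mu> (?M w))"
    using finite_measure_subadditive_finite[OF finW, of ?M] sM by (simp add: image_subset_iff)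
  then have "real k * measure \<mu> {x \<in> path_space B. (\<forall>m. P (x m)) \<and> src B (x n) \<in> W}
      \<le> real k * (\<Sum>w\<in>W. measure \<mu> (?M w))"
    by (rule mult_left_mono) simp
  also have "\<dots> \<le> (\<Sum>w\<in>W. measure \<mu> (?T w))"
    unfolding sum_distrib_left by (rule sum_mono) (rule le)
  also have "\<dots> = measure \<mu> (\<Union>w\<in>W. ?T w)"
  proof (rule finite_measure_finite_Union[symmetric])
    show "disjoint_family_on ?T W" unfolding disjoint_family_on_def by blast
  next
    show "?T ` W \<subseteq> events" using sT by blast
  qed (rule finW)
  also have "\<dots> \<le> 1" by (rule prob_le_1)
  finally show ?thesis .
qed

end


section \<open>Vectors on and off the coordinate axes\<close>

text \<open>The vectors all of whose coordinates other than the \<open>i\<close>-th vanish; the origin is on every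
  axis.\<close>

definition on_axis :: "'q \<Rightarrow> nat ^ 'q \<Rightarrow> bool" where
  "on_axis i w \<longleftrightarrow> (\<forall>j. j \<noteq> i \<longrightarrow> w $ j = 0)"

lemma on_axis_add: "on_axis i (u + s) \<longleftrightarrow> on_axis i u \<and> on_axis i s"
  by (auto simp: on_axis_def)

lemma vectors_of_sum_add:
  "u \<in> vectors_of_sum k \<Longrightarrow> s \<in> vectors_of_sum l \<Longrightarrow> u + s \<in> vectors_of_sum (k + l)"
  by (simp add: vectors_of_sum_def sum.distrib)

lemma sum_axis: "(\<Sum>i\<in>UNIV. axis j (c::nat) $ i) = c"
  by (simp add: axis_def)

lemma split_vector:
  fixes w :: "nat ^ 'q::finite"
  assumes "w \<in> vectors_of_sum (m + l)"
  shows "\<exists>r \<in> vectors_of_sum m. \<exists>s \<in> vectors_of_sum l. w = r + s"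
  using assms
proof (induction m arbitrary: w)
  case 0
  have "(0 :: nat ^ 'q) \<in> vectors_of_sum 0" by (simp add: vectors_of_sum_def)
  then show ?case using 0 by (intro bexI[of _ 0] bexI[of _ w]) auto
next
  case (Suc m)
  then have "(\<Sum>i\<in>UNIV. w $ i) \<noteq> 0" by (simp add: vectors_of_sum_def)
  then obtain i where i: "w $ i \<noteq> 0" by (metis sum.neutral)
  define w' where "w' = w - axis i 1"
  have w: "w = w' + axis i 1" using i by (auto simp: w'_def vec_eq_iff axis_def)
  have "w' \<in> vectors_of_sum (m + l)"
    using Suc.prems by (simp add: w vectors_of_sum_def sum.distrib sum_axis)
  then obtain r s where "r \<in> vectors_of_sum m" "s \<in> vectors_of_sum l" "w' = r + s"
    using Suc.IH by blast
  then show ?case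
    by (intro bexI[of _ "r + axis i 1"] bexI[of _ s])
      (auto simp: w vectors_of_sum_def sum.distrib sum_axis ac_simps)
qed

lemma off_axes_iff:
  fixes w :: "nat ^ 'q::finite"
  shows "(\<forall>i. \<not> on_axis i w) \<longleftrightarrow> (\<exists>i j. i \<noteq> j \<and> w $ i \<noteq> 0 \<and> w $ j \<noteq> 0)"
proof
  assume off: "\<forall>i. \<not> on_axis i w"
  then obtain i where "w $ i \<noteq> 0" unfolding on_axis_def by blast
  moreover from off obtain j where "j \<noteq> i" "w $ j \<noteq> 0" unfolding on_axis_def by blast
  ultimately show "\<exists>i j. i \<noteq> j \<and> w $ i \<noteq> 0 \<and> w $ j \<noteq> 0" by blast
next
  assume "\<exists>i j. i \<noteq> j \<and> w $ i \<noteq> 0 \<and> w $ j \<noteq> 0"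
  then show "\<forall>i. \<not> on_axis i w" unfolding on_axis_def by metis
qed

text \<open>A vector off the axes is at least \<open>1\<close> in two coordinates \<open>i \<noteq> j\<close>; the two decompositions
  arise by giving one of these two units to either part.  For \<open>k = 1\<close> the vectors \<open>u\<close> and \<open>u'\<close>
  are unit vectors, hence on an axis.\<close>

lemma two_predecessors:
  fixes w :: "nat ^ 'q::finite"
  assumes w: "w \<in> vectors_of_sum (k + d)" "\<forall>i. \<not> on_axis i w" and "k \<ge> 1" "d \<ge> 1"
  shows "\<exists>u s u' s'. u \<in> vectors_of_sum k \<and> s \<in> vectors_of_sum d \<and> w = u + s \<and>
    u' \<in> vectors_of_sum k \<and> s' \<in> vectors_of_sum d \<and> w = u' + s' \<and> u \<noteq> u' \<and>
    (k \<ge> 2 \<longrightarrow> (\<forall>i. \<not> on_axis i u))"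
proof -
  obtain i j where ij: "i \<noteq> j" "w $ i \<noteq> 0" "w $ j \<noteq> 0" using w(2) off_axes_iff by blast
  let ?e = "\<lambda>i. axis i 1 :: nat ^ 'q"
  define v where "v = w - ?e i - ?e j"
  have wv: "w = v + ?e i + ?e j" using ij by (auto simp: v_def vec_eq_iff axis_def)
  have "v \<in> vectors_of_sum ((k - 1) + (d - 1))"
    using w(1) assms(3,4) by (simp add: wv vectors_of_sum_def sum.distrib sum_axis)
  then obtain r t where rt: "r \<in> vectors_of_sum (k - 1)" "t \<in> vectors_of_sum (d - 1)" "v = r + t"
    using split_vector by blast
  have e: "?e l \<in> vectors_of_sum 1" for l by (simp add: vectors_of_sum_def sum_axis)
  have u: "r + ?e l \<in> vectors_of_sum k" for l
    using vectors_of_sum_add[OF rt(1) e] assms(3) by simp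
  have s: "t + ?e l \<in> vectors_of_sum d" for l
    using vectors_of_sum_add[OF rt(2) e] assms(4) by simp
  have eqs: "w = (r + ?e i) + (t + ?e j)" "w = (r + ?e j) + (t + ?e i)"
    unfolding wv rt(3) by (simp_all add: ac_simps)
  have "(r + ?e i) $ i \<noteq> (r + ?e j) $ i" using ij(1) by (simp add: axis_def)
  then have ne: "r + ?e i \<noteq> r + ?e j" by metis
  \<comment> \<open>For \<open>k \<ge> 2\<close> the vector \<open>r\<close> is nonzero, and a nonzero coordinate of \<open>r\<close> differs from \<open>i\<close>
    or from \<open>j\<close>.\<close>
  have off: "(\<forall>l. \<not> on_axis l (r + ?e i)) \<or> (\<forall>l. \<not> on_axis l (r + ?e j))" if "k \<ge> 2"
  proof -
    have "(\<Sum>l\<in>UNIV. r $ l) \<noteq> 0" using rt(1) that by (simp add: vectors_of_sum_def)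
    then obtain l where l: "r $ l \<noteq> 0" by (metis sum.neutral)
    show ?thesis
    proof (cases "l = i")
      case True
      then have "\<forall>m. \<not> on_axis m (r + ?e j)"
        unfolding off_axes_iff using l ij(1) by (intro exI[of _ i] exI[of _ j]) (simp add: axis_def)
      then show ?thesis ..
    next
      case False
      then have "\<forall>m. \<not> on_axis m (r + ?e i)"
        unfolding off_axes_iff using l by (intro exI[of _ l] exI[of _ i]) (simp add: axis_def)
      then show ?thesis ..
    qed
  qed
  show ?thesis
  proof (cases "k \<ge> 2 \<longrightarrow> (\<forall>l. \<not> on_axis l (r + ?e i))")
    case True
    then show ?thesis using u s eqs ne by blast
  next
    case False
    then show ?thesis using u s eqs ne off by metis
  qed
qed


section \<open>Diagrams of polynomial shape\<close>

context
  fixes p :: "'q::finite int_mpoly" and d :: nat and B :: "(nat ^ 'q, 'e) bratteli"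
  assumes shape: "polynomial_shape d p B" and d_pos: "d \<ge> 1"
begin

interpretation bratteli_diagram B
  using shape by (simp add: polynomial_shape_def)

lemma verts_shape: "verts B n = vectors_of_sum (n * d)"
  using shape by (simp add: polynomial_shape_def)

lemma ex_edge:
  assumes "u \<in> vectors_of_sum (n * d)" "s \<in> vectors_of_sum d"
  shows "\<exists>e \<in> edges B n. src B e = u \<and> tgt B e = u + s"
proof -
  have "u + s \<in> verts B (Suc n)"
    using vectors_of_sum_add[OF assms] by (simp add: verts_shape add.commute)
  then show ?thesis using shape assms by (auto simp: polynomial_shape_def)
qed

lemma edge_difference:
  assumes "e \<in> edges B n"
  shows "\<exists>s. tgt B e = src B e + s"
  using shape assms src_in[OF assms] tgt_in[OF assms] unfolding polynomial_shape_def by blast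

lemma on_axis_earlier:
  assumes x: "x \<in> path_space B" and "m \<le> n" "on_axis i (src B (x n))"
  shows "on_axis i (src B (x m))"
  using assms(2,3)
proof (induction n rule: dec_induct)
  case (step n)
  obtain s where "src B (x (Suc n)) = src B (x n) + s"
    using edge_difference[OF path_spaceD(1)[OF x, of n]] path_spaceD(2)[OF x, of n] by auto
  with step show ?case by (simp add: on_axis_add)
qed

lemma many_paths_off_axes:
  assumes "n \<ge> 1" "w \<in> verts B n" "\<forall>i. \<not> on_axis i w"
  shows "\<exists>F. F \<subseteq> finite_paths_to B w \<and> finite F \<and> card F = n"
  using assms
proof (induction n arbitrary: w rule: dec_induct)
  case base
  then obtain es where "es \<in> finite_paths_to B w" using ex_finite_path by blast
  then show ?case by (intro exI[of _ "{es}"]) auto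
next
  case (step n)
  have "w \<in> vectors_of_sum (n * d + d)" using step.prems by (simp add: verts_shape add.commute)
  moreover have "n * d \<ge> 1" using step.hyps d_pos by simp
  ultimately obtain u s u' s' where us: "u \<in> vectors_of_sum (n * d)" "s \<in> vectors_of_sum d"
      "w = u + s" and us': "u' \<in> vectors_of_sum (n * d)" "s' \<in> vectors_of_sum d" "w = u' + s'"
    and ne: "u \<noteq> u'" and off: "n * d \<ge> 2 \<longrightarrow> (\<forall>i. \<not> on_axis i u)"
    using two_predecessors[of w "n * d" d] step.prems(2) d_pos by blast
  \<comment> \<open>At level \<open>1\<close> both predecessors may be on an axis, but one path to each of them suffices.\<close>
  obtain F where F: "F \<subseteq> finite_paths_to B u" "finite F" "card F = n"
  proof (cases "n = 1")
    case True
    obtain es where "es \<in> finite_paths_to B u" using us(1) verts_shape ex_finite_path by blast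
    with that[of "{es}"] True show ?thesis by auto
  next
    case False
    then have "n * d \<ge> 2" using step.hyps d_pos mult_le_mono[of 2 n 1 d] by simp
    with off step.IH[of u] us(1) that show ?thesis by (auto simp: verts_shape)
  qed
  obtain e where e: "e \<in> edges B n" "src B e = u" "tgt B e = w" using ex_edge us by blast
  obtain e' where e': "e' \<in> edges B n" "src B e' = u'" "tgt B e' = w" using ex_edge us' by blast
  obtain es' where es': "es' \<in> finite_paths_to B u'" using us'(1) verts_shape ex_finite_path by blast
  let ?G = "insert (es' @ [e']) ((\<lambda>es. es @ [e]) ` F)"
  have "e \<noteq> e'" using e e' ne by auto
  then have "es' @ [e'] \<notin> (\<lambda>es. es @ [e]) ` F" by auto
  moreover have "card ((\<lambda>es. es @ [e]) ` F) = n" using F(3) by (subst card_image) (auto simp: inj_on_def)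
  ultimately have "card ?G = Suc n" using F(2) by simp
  moreover have "?G \<subseteq> finite_paths_to B w"
    using append_edge_finite_path[of u n _ e] append_edge_finite_path[of u' n _ e']
      e e' es' F(1) us(1) us'(1) by (auto simp: verts_shape)
  ultimately show ?case using F(2) by (intro exI[of _ ?G]) simp
qed

lemma axis_paths_null:
  assumes bp: "borel_probability B \<mu>" and erg: "ergodic_measure B \<mu>" and full: "fully_supported B \<mu>"
    and q: "CARD('q) \<ge> 2"
  shows "{x \<in> path_space B. \<forall>n. on_axis i (src B (x n))} \<in> null_sets \<mu>"
proof -
  interpret prob_space \<mu> using bp by (simp add: borel_probability_def)
  let ?E = "{x \<in> path_space B. \<forall>n. on_axis i (src B (x n))}"
  have sE: "?E \<in> sets \<mu>" by (rule sets_all_coordinates[OF bp])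
  have "invariant_set B ?E"
    unfolding invariant_set_def
  proof (intro conjI ballI impI)
    fix x y assume x: "x \<in> ?E" and y: "y \<in> path_space B" and "tail_equivalent x y"
    then obtain N where N: "\<forall>n\<ge>N. x n = y n" by (auto simp: tail_equivalent_def)
    have "on_axis i (src B (y n))" for n
    proof (rule on_axis_earlier[OF y, of n "max n N"])
      show "on_axis i (src B (y (max n N)))"
        using N x by (metis (no_types, lifting) max.cobounded2 mem_Collect_eq)
    qed simp
    with y show "y \<in> ?E" by simp
  qed auto
  then have dich: "emeasure \<mu> ?E = 0 \<or> emeasure \<mu> ?E = 1"
    using erg sE by (simp add: ergodic_measure_def)
  obtain j where j: "j \<noteq> i"
    using q by (metis UNIV_I card_2_iff' card_le_Suc0_iff_eq finite numeral_2_eq_2 not_less_eq_eq)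
  have "(0 :: nat ^ 'q) \<in> vectors_of_sum (0 * d)" "axis j d \<in> vectors_of_sum d"
    by (simp_all add: vectors_of_sum_def sum_axis)
  then obtain e where e: "e \<in> edges B 0" "tgt B e = axis j d" using ex_edge by fastforce
  obtain x where x: "x \<in> path_space B" "x 0 = e" using ex_path_from_edge[OF e(1)] by blast
  let ?U = "{y \<in> path_space B. y 0 = e}"
  have openU: "openin (path_topology B) ?U" by (rule openin_coordinate)
  then have "emeasure \<mu> ?U > 0" using full x unfolding fully_supported_def by blast
  moreover have "?U \<inter> ?E = {}"
  proof -
    have "\<not> on_axis i (src B (y 1))" if "y \<in> ?U" for y
    proof -
      have "src B (y 1) = axis j d" using that path_spaceD(2)[of y B 0] e(2) by auto
      then show ?thesis using j d_pos by (auto simp: on_axis_def axis_def)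
    qed
    then show ?thesis by blast
  qed
  then have "measure \<mu> ?U + measure \<mu> ?E \<le> 1"
    using finite_measure_Union[OF sets_openin[OF bp openU] sE] prob_le_1[of "?U \<union> ?E"] by simp
  ultimately have "emeasure \<mu> ?E \<noteq> 1"
    by (auto simp: emeasure_eq_measure)
  with dich sE show ?thesis by (simp add: null_sets_def)
qed

text \<open>Minimality and maximality of edges are two instances of a predicate \<open>P\<close> that holds for at most
  one edge into each vertex.\<close>

lemma selected_paths_null:
  assumes bp: "borel_probability B \<mu>" and inv: "invariant_measure B \<mu>"
    and erg: "ergodic_measure B \<mu>" and full: "fully_supported B \<mu>" and q: "CARD('q) \<ge> 2"
    and P: "\<And>n e e'. \<lbrakk>e \<in> edges B n; e' \<in> edges B n; P e; P e'; tgt B e = tgt B e'\<rbrakk> \<Longrightarrow> e = e'"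
  shows "{x \<in> path_space B. \<forall>n. P (x n)} \<in> null_sets \<mu>"
proof -
  interpret prob_space \<mu> using bp by (simp add: borel_probability_def)
  let ?M = "{x \<in> path_space B. \<forall>n. P (x n)}"
  let ?E = "\<lambda>i. {x \<in> path_space B. \<forall>n. on_axis i (src B (x n))}"
  let ?W = "\<lambda>n. {w \<in> verts B n. \<forall>i. \<not> on_axis i w}"
  let ?A = "\<lambda>n. {x \<in> path_space B. (\<forall>m. P (x m)) \<and> src B (x n) \<in> ?W n}"
  have sM: "?M \<in> sets \<mu>" by (rule sets_all_coordinates[OF bp])
  have sA: "?A n \<in> sets \<mu>" for n
  proof -
    have "?A n = ?M \<inter> {x \<in> path_space B. src B (x n) \<in> ?W n}" by blast
    moreover have "{x \<in> path_space B. src B (x n) \<in> ?W n} \<in> sets \<mu>" by (rule sets_coordinate[OF bp])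
    ultimately show ?thesis using sM by simp
  qed
  have small: "real n * measure \<mu> (?A n) \<le> 1" if "n \<ge> 1" for n
    by (rule measure_selected_le[OF bp inv P]) (use many_paths_off_axes[OF that] in auto)
  have mono: "?A m \<subseteq> ?A n" if "m \<le> n" for m n
  proof
    fix x assume x: "x \<in> ?A m"
    then have "src B (x n) \<in> verts B n" using src_in path_spaceD(1) by blast
    moreover have "\<not> on_axis i (src B (x n))" for i using on_axis_earlier[of x m n i] that x by blast
    ultimately show "x \<in> ?A n" using x by blast
  qed
  have nullA: "?A m \<in> null_sets \<mu>" for m
  proof -
    have "measure \<mu> (?A m) = 0"
    proof (rule ccontr)
      assume "measure \<mu> (?A m) \<noteq> 0"
      then have pos: "measure \<mu> (?A m) > 0" by (simp add: zero_less_measure_iff)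
      then obtain k where k: "1 < real k * measure \<mu> (?A m)" using reals_Archimedean3 by blast
      define n where "n = max (max k m) 1"
      have "real k * measure \<mu> (?A m) \<le> real n * measure \<mu> (?A n)"
        by (rule mult_mono) (use finite_measure_mono[OF mono sA, of m n] in \<open>auto simp: n_def\<close>)
      with k small[of n] show False by (simp add: n_def)
    qed
    then show ?thesis using sA by (simp add: null_sets_def emeasure_eq_measure)
  qed
  have "?M \<subseteq> (\<Union>m. ?A m) \<union> (\<Union>i. ?E i)"
  proof
    fix x assume x: "x \<in> ?M"
    show "x \<in> (\<Union>m. ?A m) \<union> (\<Union>i. ?E i)"
    proof (cases "\<exists>i. x \<in> ?E i")
      case False
      then have "\<forall>i. \<exists>n. \<not> on_axis i (src B (x n))" using x by blast
      then obtain f where f: "\<And>i. \<not> on_axis i (src B (x (f i)))" by metis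
      define N where "N = Max (range f)"
      have "\<not> on_axis i (src B (x N))" for i
        using on_axis_earlier[of x "f i" N i] f[of i] x by (auto simp: N_def)
      moreover have "src B (x N) \<in> verts B N" using x src_in path_spaceD(1) by blast
      ultimately show ?thesis using x by blast
    qed blast
  qed
  moreover have "(\<Union>m. ?A m) \<union> (\<Union>i. ?E i) \<in> null_sets \<mu>"
    by (intro null_sets.Un null_sets_UN' nullA axis_paths_null[OF bp erg full q])
      (auto simp: countable_finite)
  ultimately show ?thesis using null_sets_subset sM by blast
qed

end

section \<open>Minimal and maximal paths\<close>

lemma edge_ordering_injD:
  assumes "bratteli_diagram B" "edge_ordering B \<xi>" "e \<in> edges B n" "e' \<in> edges B n"
    and "tgt B e = tgt B e'" "\<xi> e = \<xi> e'"
  shows "e = e'"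
proof -
  interpret bratteli_diagram B by fact
  have "tgt B e \<in> (\<Union>n. verts B n) - verts B 0"
    using tgt_in[OF assms(3)] verts_disjoint[of 0 "Suc n"] by auto
  then have "inj_on \<xi> (in_edges B (tgt B e))"
    using assms(2) by (auto simp: edge_ordering_def bij_betw_def)
  then show ?thesis using assms by (auto simp: in_edges_def inj_on_def)
qed

theorem proposition3p6:
  fixes p :: "'q::finite int_mpoly"
    and d :: nat
    and B :: "(nat ^ 'q, 'e) bratteli"
    and \<xi> :: "'e \<Rightarrow> nat"
    and \<mu> :: "(nat \<Rightarrow> 'e) measure"
  assumes "CARD('q) \<ge> 2"
    and "d \<ge> 1"
    and "polynomial_shape d p B"
    and "edge_ordering B \<xi>"
    and "borel_probability B \<mu>"
    and "invariant_measure B \<mu>"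
    and "ergodic_measure B \<mu>"
    and "fully_supported B \<mu>"
  shows "maximal_paths B \<xi> \<in> null_sets \<mu> \<and> minimal_paths B \<xi> \<in> null_sets \<mu>"
proof -
  have bd: "bratteli_diagram B" using assms(3) by (simp add: polynomial_shape_def)
  have in_edgesI: "e \<in> in_edges B (tgt B e')" if "e \<in> edges B n" "tgt B e = tgt B e'" for e e' n
    using that by (auto simp: in_edges_def)
  note null = selected_paths_null[OF assms(3,2,5,6,7,8,1)]
  show ?thesis
    unfolding maximal_paths_def minimal_paths_def
  proof (intro conjI null)
    fix n e e'
    assume e: "e \<in> edges B n" "e' \<in> edges B n" "tgt B e = tgt B e'"
    {
      assume "\<forall>f \<in> in_edges B (tgt B e). \<xi> f \<le> \<xi> e" "\<forall>f \<in> in_edges B (tgt B e'). \<xi> f \<le> \<xi> e'"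
      then have "\<xi> e = \<xi> e'" using in_edgesI e by (metis order_antisym)
      then show "e = e'" using edge_ordering_injD[OF bd assms(4)] e by blast
    next
      assume "\<forall>f \<in> in_edges B (tgt B e). \<xi> e \<le> \<xi> f" "\<forall>f \<in> in_edges B (tgt B e'). \<xi> e' \<le> \<xi> f"
      then have "\<xi> e = \<xi> e'" using in_edgesI e by (metis order_antisym)
      then show "e = e'" using edge_ordering_injD[OF bd assms(4)] e by blast
    }
  qed
qed

end
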